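(* Let $(K,|\cdot|)$ be a complete non-Archimedean valued field, $(X,\|\cdot\|)$ a non-Archimedean normed linear space over $K$, and $(Y,\widehat d_Y)$ a non-Archimedean metric space, such that every ball in $X$ and every ball in $Y$ contains at least two distinct elements. For any $P_1,P_2\in\mathfrak D_\flat(X,Y)$ and $a\in K^{\times}=K\setminus\{0\}$, $$\widehat\beta_{X,Y}^{|a|}(P_1,P_2)=\widehat\beta_{X,Y}(P_1^{a},P_2^{a})\quad\text{and}\quad\widehat\beta_{X,Y}^{\ast|a|}(P_1,P_2)=\widehat\beta_{X,Y}^{\ast}(P_1^{a},P_2^{a}).$$ In particular, if $Y=K$ (with the metric $|\alpha-\beta|$), then $$\widehat\beta_{X,Y}^{|a|}(P_1,P_2)=|a|^{-1}\cdot\widehat\beta_{X,Y}(aP_1,aP_2)\quad\text{and}\quad\widehat\beta_{X,Y}^{\ast|a|}(P_1,P_2)=|a|^{-1}\cdot\widehat\beta_{X,Y}^{\ast}(aP_1,aP_2).$$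
   Context: $X$ carries the metric $\widehat d_X(x,y)=\|x-y\|$. Metrics may take the value $+\infty$, and $\inf\emptyset=+\infty$. A ball in $X$ is a set $\{x:\widehat d_X(b,x)<r\}$ or $\{x:\widehat d_X(b,x)\le r\}$ with $b\in X$, $0<r<\infty$; $\mathcal M_\flat(X)$ is the set of all balls in $X$. For $B\in\mathcal M_\flat(X)$ and $\varepsilon>0$, $B^{\varepsilon}=\{x\in X:\operatorname{dist}(x,B)<\varepsilon\}$ with $\operatorname{dist}(x,B)=\inf_{b\in B}\widehat d_X(x,b)$; it is again a ball. $\mathfrak D_\flat(X,Y)$ is the set of all maps $P:\mathcal M_\flat(X)\to Y$. For $a\in K^\times$ and $B\in\mathcal M_\flat(X)$, $a\cdot B=\{a v:v\in B\}\in\mathcal M_\flat(X)$; $P^{a}(B)=P(a\cdot B)$; and when $Y=K$, $(aP)(B)=a\cdot P(B)$. For $\lambda>0$ and $P_1\ne P_2$, $\widehat\beta_{X,Y}^{\lambda}(P_1,P_2)$ is the infimum of all $\varepsilon>0$ such that $\widehat d_Y(P_1(B),P_2(B^{\lambda\varepsilon}))\le\varepsilon$ and $\widehat d_Y(P_2(B),P_1(B^{\lambda\varepsilon}))\le\varepsilon$ for all $B\in\mathcal M_\flat(X)$; $\widehat\beta_{X,Y}^{\lambda}(P,P)=0$. $\widehat\beta_{X,Y}^{\ast\lambda}(P_1,P_2)$ is the infimum of all $\varepsilon>0$ such that for every $B\in\mathcal M_\flat(X)$ there exist positive numbers $\varepsilon_B,\varepsilon_B'\le\varepsilon$ with $\widehat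 d_Y(P_1(B),P_2(B^{\lambda\varepsilon_B}))\le\varepsilon$ and $\widehat d_Y(P_2(B),P_1(B^{\lambda\varepsilon_B'}))\le\varepsilon$. $\widehat\beta_{X,Y}=\widehat\beta_{X,Y}^{1}$, $\widehat\beta_{X,Y}^{\ast}=\widehat\beta_{X,Y}^{\ast1}$. *)

theory Defs
  imports "HOL-Analysis.Abstract_Metric_Spaces" "HOL-Library.Extended_Nonnegative_Real"
    "HOL-Library.FuncSet"
begin

text \<open>The absolute value is an explicit parameter: the library's normed algebraic classes are
  algebras over the reals and hence Archimedean.  The trivial absolute value is allowed.\<close>

locale nonarch_valued_field =
  fixes v :: "'k::field \<Rightarrow> real"
  assumes v_nonneg: "0 \<le> v x"
    and v_eq_0_iff: "v x = 0 \<longleftrightarrow> x = 0"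
    and v_mult: "v (x * y) = v x * v y"
    and v_ultra: "v (x + y) \<le> max (v x) (v y)"
begin

lemma v_1: "v 1 = 1"
  using v_mult[of 1 1] v_eq_0_iff[of 1] by simp

lemma v_minus: "v (- x) = v x"
proof -
  have "v (- 1) * v (- 1) = 1"
    using v_mult[of "- 1" "- 1"] v_1 by simp
  then have "(v (- 1))\<^sup>2 = 1"
    by (simp add: power2_eq_square)
  then have "v (- 1) = 1"
    using v_nonneg[of "- 1"] by (auto simp: power2_eq_1_iff)
  then show ?thesis
    using v_mult[of "- 1" x] by simp
qed

sublocale vdist: Metric_space UNIV "\<lambda>x y. v (x - y)"
proof
  fix x y z :: 'k
  show "0 \<le> v (x - y)" by (rule v_nonneg)
  show "v (x - y) = v (y - x)" using v_minus[of "x - y"] by simp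
  show "v (x - y) = 0 \<longleftrightarrow> x = y" by (simp add: v_eq_0_iff)
  show "v (x - z) \<le> v (x - y) + v (y - z)"
    using v_ultra[of "x - y" "y - z"] v_nonneg[of "x - y"] v_nonneg[of "y - z"] by simp
qed

end

locale complete_nonarch_valued_field = nonarch_valued_field v
  for v :: "'k::field \<Rightarrow> real" +
  assumes v_complete: "vdist.mcomplete"

locale nonarch_normed_space = nonarch_valued_field v + vector_space smul
  for v :: "'k::field \<Rightarrow> real"
    and smul :: "'k \<Rightarrow> 'x::ab_group_add \<Rightarrow> 'x" +
  fixes N :: "'x \<Rightarrow> real"
  assumes N_nonneg: "0 \<le> N x"
    and N_eq_0_iff: "N x = 0 \<longleftrightarrow> x = 0"
    and N_scale: "N (smul c x) = v c * N x"
    and N_ultra: "N (x + y) \<le> max (N x) (N y)"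

text \<open>Metrics may take the value \<open>\<infinity>\<close>, so they are valued in \<^typ>\<open>ennreal\<close>.\<close>

locale nonarch_metric =
  fixes d :: "'y \<Rightarrow> 'y \<Rightarrow> ennreal"
  assumes d_eq_0_iff: "d x y = 0 \<longleftrightarrow> x = y"
    and d_sym: "d x y = d y x"
    and d_ultra: "d x z \<le> max (d x y) (d y z)"

definition norm_dist :: "('a::ab_group_add \<Rightarrow> real) \<Rightarrow> 'a \<Rightarrow> 'a \<Rightarrow> ennreal" where
  "norm_dist N x y = ennreal (N (x - y))"

definition balls :: "('a \<Rightarrow> 'a \<Rightarrow> ennreal) \<Rightarrow> 'a set set" where
  "balls d = {B. \<exists>b (r::real). 0 < r \<and>
     (B = {x. d b x < ennreal r} \<or> B = {x. d b x \<le> ennreal r})}"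

definition balls_nonsingleton :: "('a \<Rightarrow> 'a \<Rightarrow> ennreal) \<Rightarrow> bool" where
  "balls_nonsingleton d \<longleftrightarrow> (\<forall>B \<in> balls d. \<exists>x \<in> B. \<exists>y \<in> B. x \<noteq> y)"

definition dist_to_set :: "('a \<Rightarrow> 'a \<Rightarrow> ennreal) \<Rightarrow> 'a \<Rightarrow> 'a set \<Rightarrow> ennreal" where
  "dist_to_set d x B = (INF b\<in>B. d x b)"

definition fatten :: "('a \<Rightarrow> 'a \<Rightarrow> ennreal) \<Rightarrow> 'a set \<Rightarrow> real \<Rightarrow> 'a set" where
  "fatten d B \<epsilon> = {x. dist_to_set d x B < ennreal \<epsilon>}"

text \<open>Maps defined on balls only are encoded as extensional functions (\<^const>\<open>undefined\<close> off
  the set of balls), so that HOL equality of two such functions is equality of maps.\<close>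

definition ball_maps :: "('x \<Rightarrow> 'x \<Rightarrow> ennreal) \<Rightarrow> ('x set \<Rightarrow> 'y) set" where
  "ball_maps dX = (balls dX \<rightarrow>\<^sub>E UNIV)"

definition pre_scale ::
  "('x \<Rightarrow> 'x \<Rightarrow> ennreal) \<Rightarrow> ('k \<Rightarrow> 'x \<Rightarrow> 'x) \<Rightarrow> 'k \<Rightarrow> ('x set \<Rightarrow> 'y) \<Rightarrow> 'x set \<Rightarrow> 'y" where
  "pre_scale dX smul a P = (\<lambda>B \<in> balls dX. P (smul a ` B))"

definition post_scale ::
  "('x \<Rightarrow> 'x \<Rightarrow> ennreal) \<Rightarrow> 'k::field \<Rightarrow> ('x set \<Rightarrow> 'k) \<Rightarrow> 'x set \<Rightarrow> 'k" where
  "post_scale dX a P = (\<lambda>B \<in> balls dX. a * P B)"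

definition beta ::
  "('x \<Rightarrow> 'x \<Rightarrow> ennreal) \<Rightarrow> ('y \<Rightarrow> 'y \<Rightarrow> ennreal) \<Rightarrow> real \<Rightarrow>
   ('x set \<Rightarrow> 'y) \<Rightarrow> ('x set \<Rightarrow> 'y) \<Rightarrow> ennreal" where
  "beta dX dY l P1 P2 =
    (if P1 = P2 then 0
     else Inf {ennreal \<epsilon> | \<epsilon>. 0 < \<epsilon> \<and>
       (\<forall>B \<in> balls dX. dY (P1 B) (P2 (fatten dX B (l * \<epsilon>))) \<le> ennreal \<epsilon> \<and>
                       dY (P2 B) (P1 (fatten dX B (l * \<epsilon>))) \<le> ennreal \<epsilon>)})"

text \<open>No separate clause for equal arguments: the value is then \<open>0\<close> anyway over an ultrametric \<open>dX\<close>,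
  since enlarging a ball of radius \<open>r\<close> by less than \<open>r\<close> does not change it.\<close>

definition beta_star ::
  "('x \<Rightarrow> 'x \<Rightarrow> ennreal) \<Rightarrow> ('y \<Rightarrow> 'y \<Rightarrow> ennreal) \<Rightarrow> real \<Rightarrow>
   ('x set \<Rightarrow> 'y) \<Rightarrow> ('x set \<Rightarrow> 'y) \<Rightarrow> ennreal" where
  "beta_star dX dY l P1 P2 =
    Inf {ennreal \<epsilon> | \<epsilon>. 0 < \<epsilon> \<and>
      (\<forall>B \<in> balls dX. \<exists>\<epsilon>1 \<epsilon>2. 0 < \<epsilon>1 \<and> \<epsilon>1 \<le> \<epsilon> \<and> 0 < \<epsilon>2 \<and> \<epsilon>2 \<le> \<epsilon> \<and>
         dY (P1 B) (P2 (fatten dX B (l * \<epsilon>1))) \<le> ennreal \<epsilon> \<and>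
         dY (P2 B) (P1 (fatten dX B (l * \<epsilon>2))) \<le> ennreal \<epsilon>)}"

end

theory Submission
  imports Defs
begin

text \<open>Both parts are changes of variables. Put \<open>T x = a x\<close>. Since \<open>N (T x) = v a * N x\<close> and
  \<open>T\<close> is invertible, \<open>B \<mapsto> T ` B\<close> permutes the balls (\<open>image_smul_balls\<close>), and it carries the
  \<open>\<epsilon>\<close>-enlargement of \<open>B\<close> to the \<open>v a * \<epsilon>\<close>-enlargement of \<open>T ` B\<close> (\<open>image_smul_fatten\<close>). Hence the
  inequalities required of \<open>P1\<close>, \<open>P2\<close> at the ball \<open>T ` B\<close> with parameter \<open>v a\<close> are those required of
  the pre-scaled maps at \<open>B\<close> with parameter 1, for the same \<open>\<epsilon>\<close>, so the two infima run over the same set.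

  For the post-scaled maps the balls stay put and \<open>\<epsilon>\<close> is rescaled instead: multiplication by \<open>a\<close>
  multiplies distances in the field by \<open>v a\<close>, so a number \<open>\<epsilon>\<close> is admissible for \<open>Q1\<close>, \<open>Q2\<close> with
  parameter \<open>v a\<close> exactly when \<open>v a * \<epsilon>\<close> is admissible for the scaled maps with parameter 1; both conditions
  speak of the same enlargement of \<open>B\<close>, by \<open>v a * \<epsilon>\<close>. The infimum scales accordingly
  (\<open>Inf_admissible_rescale\<close>).

  The scaled maps are given by their formulas only on balls, so both parts rely on an
  enlargement of a ball being a ball (\<open>fatten_in_balls\<close>), which is where the ultrametric
  inequality enters.\<close>

section \<open>Enlargements of ultrametric balls\<close>

lemma in_fatten_iff: "x \<in> fatten d B \<epsilon> \<longleftrightarrow> (\<exists>b\<in>B. d x b < ennreal \<epsilon>)"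
  by (simp add: fatten_def dist_to_set_def INF_less_iff)

text \<open>By the ultrametric inequality, enlarging a ball of radius \<open>r\<close> by \<open>\<epsilon> \<le> r\<close> returns the ball
  itself, and for \<open>\<epsilon> > r\<close> it yields the open ball of radius \<open>\<epsilon>\<close> about the same centre.\<close>

lemma (in nonarch_metric) fatten_in_balls:
  assumes "B \<in> balls d" "0 < \<epsilon>"
  shows "fatten d B \<epsilon> \<in> balls d"
proof -
  from assms(1) obtain b r where r: "0 < r"
    and B: "B = {x. d b x < ennreal r} \<or> B = {x. d b x \<le> ennreal r}"
    unfolding balls_def by blast
  have bB: "b \<in> B"
    using B r d_eq_0_iff[of b b] by auto
  have within: "d b y \<le> ennreal r" if "y \<in> B" for y
    using B that by auto
  show ?thesis
  proof (cases "\<epsilon> \<le> r")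
    case True
    have "fatten d B \<epsilon> = B"
    proof (intro set_eqI iffI)
      fix x assume "x \<in> fatten d B \<epsilon>"
      then obtain y where y: "y \<in> B" "d x y < ennreal \<epsilon>"
        by (auto simp: in_fatten_iff)
      have "d y x < ennreal r"
        using y(2) True by (metis d_sym ennreal_leI less_le_trans)
      with y(1) d_ultra[of b x y] show "x \<in> B"
        using B by (auto simp: le_max_iff_disj)
    next
      fix x assume "x \<in> B"
      then show "x \<in> fatten d B \<epsilon>"
        using assms(2) d_eq_0_iff[of x x] by (auto simp: in_fatten_iff intro!: bexI[of _ x])
    qed
    then show ?thesis using assms(1) by simp
  next
    case False
    then have lt: "ennreal r < ennreal \<epsilon>"
      using r by (simp add: ennreal_less_iff)
    have "fatten d B \<epsilon> = {x. d b x < ennreal \<epsilon>}"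
    proof (intro set_eqI iffI)
      fix x assume "x \<in> fatten d B \<epsilon>"
      then obtain y where y: "y \<in> B" "d x y < ennreal \<epsilon>"
        by (auto simp: in_fatten_iff)
      have "max (d b y) (d y x) < ennreal \<epsilon>"
        using within[OF y(1)] lt y(2) d_sym[of x y] by auto
      then have "d b x < ennreal \<epsilon>"
        by (rule le_less_trans[OF d_ultra])
      then show "x \<in> {x. d b x < ennreal \<epsilon>}" by simp
    next
      fix x assume "x \<in> {x. d b x < ennreal \<epsilon>}"
      then show "x \<in> fatten d B \<epsilon>"
        using bB d_sym[of b x] by (auto simp: in_fatten_iff)
    qed
    then show ?thesis using assms(2) unfolding balls_def by blast
  qed
qed

lemma (in nonarch_normed_space) nonarch_metric_norm_dist: "nonarch_metric (norm_dist N)"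
proof
  have N_minus: "N (- x) = N x" for x
    using N_scale[of "- 1" x] v_minus[of 1] v_1 by simp
  fix x y z
  show "norm_dist N x y = 0 \<longleftrightarrow> x = y"
    using N_nonneg[of "x - y"] by (simp add: norm_dist_def ennreal_eq_0_iff N_eq_0_iff antisym_conv)
  show "norm_dist N x y = norm_dist N y x"
    using N_minus[of "x - y"] by (simp add: norm_dist_def)
  have "ennreal (N (x - z)) \<le> ennreal (max (N (x - y)) (N (y - z)))"
    using N_ultra[of "x - y" "y - z"] by (intro ennreal_leI) simp
  then show "norm_dist N x z \<le> max (norm_dist N x y) (norm_dist N y z)"
    by (auto simp: norm_dist_def max_def split: if_splits)
qed

section \<open>Scalar multiplication on balls\<close>

context nonarch_normed_space
begin

lemma v_pos: "a \<noteq> 0 \<Longrightarrow> 0 < v a"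
  using v_nonneg[of a] v_eq_0_iff[of a] by simp

lemma norm_dist_smul_less_iff:
  assumes "a \<noteq> 0"
  shows "norm_dist N (smul a x) (smul a y) < ennreal (v a * r) \<longleftrightarrow> norm_dist N x y < ennreal r"
  using v_pos[OF assms]
  by (cases "0 < r")
    (auto simp: norm_dist_def N_scale ennreal_less_iff N_nonneg ennreal_neg mult_nonneg_nonpos
      simp flip: scale_right_diff_distrib)

lemma norm_dist_smul_le_iff:
  assumes "a \<noteq> 0" "0 < r"
  shows "norm_dist N (smul a x) (smul a y) \<le> ennreal (v a * r) \<longleftrightarrow> norm_dist N x y \<le> ennreal r"
  using v_pos[OF assms(1)] assms(2)
  by (auto simp: norm_dist_def N_scale ennreal_le_iff simp flip: scale_right_diff_distrib)

lemma image_smul_Collect: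
  assumes "a \<noteq> 0"
  shows "smul a ` {x. \<phi> (smul a x)} = {x. \<phi> x}"
proof (intro set_eqI iffI)
  fix x assume "x \<in> {x. \<phi> x}"
  then show "x \<in> smul a ` {x. \<phi> (smul a x)}"
    using assms by (intro image_eqI[of _ _ "smul (inverse a) x"]) simp_all
qed auto

lemma image_smul_in_balls:
  assumes "a \<noteq> 0" "B \<in> balls (norm_dist N)"
  shows "smul a ` B \<in> balls (norm_dist N)"
proof -
  from assms(2) obtain b r where r: "0 < r"
    and B: "B = {x. norm_dist N b x < ennreal r} \<or> B = {x. norm_dist N b x \<le> ennreal r}"
    unfolding balls_def by blast
  have "smul a ` {x. norm_dist N b x < ennreal r}
      = {x. norm_dist N (smul a b) x < ennreal (v a * r)}"
    using image_smul_Collect[OF assms(1), of "\<lambda>x. norm_dist N (smul a b) x < ennreal (v a * r)"]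
    by (simp add: norm_dist_smul_less_iff assms(1))
  moreover have "smul a ` {x. norm_dist N b x \<le> ennreal r}
      = {x. norm_dist N (smul a b) x \<le> ennreal (v a * r)}"
    using image_smul_Collect[OF assms(1), of "\<lambda>x. norm_dist N (smul a b) x \<le> ennreal (v a * r)"]
    by (simp add: norm_dist_smul_le_iff assms(1) r)
  moreover have "0 < v a * r"
    using v_pos[OF assms(1)] r by simp
  ultimately show ?thesis
    using B unfolding balls_def by blast
qed

lemma image_smul_balls:
  assumes "a \<noteq> 0"
  shows "(`) (smul a) ` balls (norm_dist N) = balls (norm_dist N)"
proof (intro equalityI subsetI)
  fix B assume B: "B \<in> balls (norm_dist N)"
  have "B = smul a ` smul (inverse a) ` B"
    using assms by (simp add: image_image)
  moreover have "smul (inverse a) ` B \<in> balls (norm_dist N)"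
    using assms B by (intro image_smul_in_balls) simp_all
  ultimately show "B \<in> (`) (smul a) ` balls (norm_dist N)" by blast
qed (use assms image_smul_in_balls in auto)

lemma all_balls_smul_iff:
  assumes "a \<noteq> 0"
  shows "(\<forall>B\<in>balls (norm_dist N). \<phi> (smul a ` B)) \<longleftrightarrow> (\<forall>B\<in>balls (norm_dist N). \<phi> B)"
  by (subst (2) image_smul_balls[OF assms, symmetric]) simp

lemma image_smul_fatten:
  assumes "a \<noteq> 0"
  shows "smul a ` fatten (norm_dist N) B \<epsilon> = fatten (norm_dist N) (smul a ` B) (v a * \<epsilon>)"
proof -
  have "fatten (norm_dist N) B \<epsilon> = {x. smul a x \<in> fatten (norm_dist N) (smul a ` B) (v a * \<epsilon>)}"
    by (auto simp: in_fatten_iff norm_dist_smul_less_iff assms)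
  then show ?thesis
    using image_smul_Collect[OF assms, of "\<lambda>x. x \<in> fatten (norm_dist N) (smul a ` B) (v a * \<epsilon>)"]
    by simp
qed

lemmas fatten_norm_dist_in_balls = nonarch_metric.fatten_in_balls[OF nonarch_metric_norm_dist]

section \<open>Scaling the argument\<close>

lemma pre_scale_fatten:
  assumes "a \<noteq> 0" "B \<in> balls (norm_dist N)" "0 < \<epsilon>"
  shows "pre_scale (norm_dist N) smul a P (fatten (norm_dist N) B \<epsilon>)
    = P (fatten (norm_dist N) (smul a ` B) (v a * \<epsilon>))"
  using assms by (simp add: pre_scale_def fatten_norm_dist_in_balls image_smul_fatten)

text \<open>Needed because \<^const>\<open>beta\<close> treats equal arguments separately: the scaled maps must
  coincide only when the original maps do.\<close>

lemma pre_scale_eq_iff: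
  assumes "a \<noteq> 0" "P1 \<in> ball_maps (norm_dist N)" "P2 \<in> ball_maps (norm_dist N)"
  shows "pre_scale (norm_dist N) smul a P1 = pre_scale (norm_dist N) smul a P2 \<longleftrightarrow> P1 = P2"
proof
  assume "pre_scale (norm_dist N) smul a P1 = pre_scale (norm_dist N) smul a P2"
  then have "P1 (smul a ` B) = P2 (smul a ` B)" if "B \<in> balls (norm_dist N)" for B
    using that by (auto simp: pre_scale_def dest: fun_cong[of _ _ B])
  then have "\<forall>B\<in>balls (norm_dist N). P1 B = P2 B"
    using all_balls_smul_iff[OF assms(1), of "\<lambda>B. P1 B = P2 B"] by simp
  then show "P1 = P2"
    using assms(2,3) unfolding ball_maps_def by (auto intro: PiE_ext)
qed simp

lemma beta_pre_scale:
  assumes "a \<noteq> 0" "P1 \<in> ball_maps (norm_dist N)" "P2 \<in> ball_maps (norm_dist N)"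
  shows "beta (norm_dist N) dY (v a) P1 P2
    = beta (norm_dist N) dY 1 (pre_scale (norm_dist N) smul a P1) (pre_scale (norm_dist N) smul a P2)"
proof -
  let ?d = "norm_dist N"
  let ?p = "pre_scale ?d smul a"
  have "(\<forall>B\<in>balls ?d. dY (?p P1 B) (?p P2 (fatten ?d B (1 * \<epsilon>))) \<le> ennreal \<epsilon>
          \<and> dY (?p P2 B) (?p P1 (fatten ?d B (1 * \<epsilon>))) \<le> ennreal \<epsilon>)
      \<longleftrightarrow> (\<forall>B\<in>balls ?d. dY (P1 B) (P2 (fatten ?d B (v a * \<epsilon>))) \<le> ennreal \<epsilon>
          \<and> dY (P2 B) (P1 (fatten ?d B (v a * \<epsilon>))) \<le> ennreal \<epsilon>)" if "0 < \<epsilon>" for \<epsilon>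
    by (subst all_balls_smul_iff[OF assms(1), symmetric], intro ball_cong refl)
      (simp add: pre_scale_fatten[OF assms(1) _ that], simp add: pre_scale_def)
  then show ?thesis
    unfolding beta_def pre_scale_eq_iff[OF assms] by (simp cong: conj_cong)
qed

lemma beta_star_pre_scale:
  assumes "a \<noteq> 0"
  shows "beta_star (norm_dist N) dY (v a) P1 P2
    = beta_star (norm_dist N) dY 1
        (pre_scale (norm_dist N) smul a P1) (pre_scale (norm_dist N) smul a P2)"
proof -
  let ?d = "norm_dist N"
  let ?p = "pre_scale ?d smul a"
  have "(\<forall>B\<in>balls ?d. \<exists>\<epsilon>1 \<epsilon>2. 0 < \<epsilon>1 \<and> \<epsilon>1 \<le> \<epsilon> \<and> 0 < \<epsilon>2 \<and> \<epsilon>2 \<le> \<epsilon>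
          \<and> dY (?p P1 B) (?p P2 (fatten ?d B (1 * \<epsilon>1))) \<le> ennreal \<epsilon>
          \<and> dY (?p P2 B) (?p P1 (fatten ?d B (1 * \<epsilon>2))) \<le> ennreal \<epsilon>)
      \<longleftrightarrow> (\<forall>B\<in>balls ?d. \<exists>\<epsilon>1 \<epsilon>2. 0 < \<epsilon>1 \<and> \<epsilon>1 \<le> \<epsilon> \<and> 0 < \<epsilon>2 \<and> \<epsilon>2 \<le> \<epsilon>
          \<and> dY (P1 B) (P2 (fatten ?d B (v a * \<epsilon>1))) \<le> ennreal \<epsilon>
          \<and> dY (P2 B) (P1 (fatten ?d B (v a * \<epsilon>2))) \<le> ennreal \<epsilon>)" for \<epsilon>
    by (subst all_balls_smul_iff[OF assms, symmetric], intro ball_cong refl)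
      (simp add: pre_scale_fatten[OF assms] cong: conj_cong, simp add: pre_scale_def)
  then show ?thesis
    unfolding beta_star_def by simp
qed

section \<open>Scaling the value\<close>

lemma post_scale_eq_iff:
  assumes "a \<noteq> 0" "Q1 \<in> ball_maps d" "Q2 \<in> ball_maps d"
  shows "post_scale d a Q1 = post_scale d a Q2 \<longleftrightarrow> Q1 = Q2"
proof
  assume "post_scale d a Q1 = post_scale d a Q2"
  then have "a * Q1 B = a * Q2 B" if "B \<in> balls d" for B
    using that by (auto simp: post_scale_def dest: fun_cong[of _ _ B])
  then show "Q1 = Q2"
    using assms unfolding ball_maps_def by (auto intro: PiE_ext)
qed simp

lemma post_scale_dist_le_iff:
  assumes "a \<noteq> 0" "0 < \<epsilon>" "B \<in> balls d" "C \<in> balls d"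
  shows "norm_dist v (post_scale d a Q1 B) (post_scale d a Q2 C) \<le> ennreal (v a * \<epsilon>)
    \<longleftrightarrow> norm_dist v (Q1 B) (Q2 C) \<le> ennreal \<epsilon>"
  using assms v_pos[OF assms(1)]
  by (simp add: post_scale_def norm_dist_def v_mult flip: right_diff_distrib)

end

text \<open>The substitution \<open>\<epsilon> \<mapsto> c * \<epsilon>\<close> is an order automorphism of the positive reals, hence commutes
  with infima. If no \<open>\<epsilon>\<close> is admissible, both sides are \<open>\<infinity>\<close>, because \<open>c\<close> is positive and finite.\<close>

lemma Inf_admissible_rescale:
  fixes c :: real
  assumes c: "0 < c" and iff: "\<And>\<epsilon>. 0 < \<epsilon> \<Longrightarrow> \<phi> \<epsilon> \<longleftrightarrow> \<psi> (c * \<epsilon>)"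
  shows "Inf {ennreal \<epsilon> | \<epsilon>. 0 < \<epsilon> \<and> \<phi> \<epsilon>}
    = ennreal (inverse c) * Inf {ennreal \<epsilon> | \<epsilon>. 0 < \<epsilon> \<and> \<psi> \<epsilon>}" (is "?L = _ * ?R")
proof (rule antisym)
  have inv: "ennreal (inverse c) * (ennreal c * x) = x" for x
    using c by (simp flip: mult.assoc ennreal_mult)
  have "ennreal c * ?L \<le> ?R"
  proof (rule Inf_greatest)
    fix x assume "x \<in> {ennreal \<epsilon> | \<epsilon>. 0 < \<epsilon> \<and> \<psi> \<epsilon>}"
    then obtain \<epsilon> where \<epsilon>: "x = ennreal \<epsilon>" "0 < \<epsilon>" "\<psi> \<epsilon>" by blast
    have "0 < \<epsilon> / c" "\<phi> (\<epsilon> / c)"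
      using \<epsilon> c iff[of "\<epsilon> / c"] by simp_all
    then have "?L \<le> ennreal (\<epsilon> / c)" by (intro Inf_lower) blast
    then have "ennreal c * ?L \<le> ennreal c * ennreal (\<epsilon> / c)" by (rule mult_left_mono) simp
    also have "\<dots> = x" using \<epsilon> c by (simp flip: ennreal_mult)
    finally show "ennreal c * ?L \<le> x" .
  qed
  then show "?L \<le> ennreal (inverse c) * ?R"
    using mult_left_mono[of "ennreal c * ?L" ?R "ennreal (inverse c)"] by (simp add: inv)
  show "ennreal (inverse c) * ?R \<le> ?L"
  proof (rule Inf_greatest)
    fix x assume "x \<in> {ennreal \<epsilon> | \<epsilon>. 0 < \<epsilon> \<and> \<phi> \<epsilon>}"
    then obtain \<epsilon> where \<epsilon>: "x = ennreal \<epsilon>" "0 < \<epsilon>" "\<phi> \<epsilon>" by blast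
    have "0 < c * \<epsilon>" "\<psi> (c * \<epsilon>)"
      using \<epsilon> c iff[of \<epsilon>] by simp_all
    then have "?R \<le> ennreal (c * \<epsilon>)" by (intro Inf_lower) blast
    then have "ennreal (inverse c) * ?R \<le> ennreal (inverse c) * ennreal (c * \<epsilon>)"
      by (rule mult_left_mono) simp
    also have "\<dots> = x" using \<epsilon> c by (simp add: ennreal_mult inv)
    finally show "ennreal (inverse c) * ?R \<le> x" .
  qed
qed

context nonarch_normed_space
begin

lemma beta_post_scale:
  assumes "a \<noteq> 0" "Q1 \<in> ball_maps (norm_dist N)" "Q2 \<in> ball_maps (norm_dist N)"
  shows "beta (norm_dist N) (norm_dist v) (v a) Q1 Q2
    = ennreal (inverse (v a)) * beta (norm_dist N) (norm_dist v) 1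
        (post_scale (norm_dist N) a Q1) (post_scale (norm_dist N) a Q2)"
proof (cases "Q1 = Q2")
  case True
  then show ?thesis by (simp add: beta_def)
next
  case False
  have pos: "0 < v a * \<epsilon>" if "0 < \<epsilon>" for \<epsilon>
    using that v_pos[OF assms(1)] by simp
  show ?thesis
    unfolding beta_def post_scale_eq_iff[OF assms] if_not_P[OF False]
    by (intro Inf_admissible_rescale v_pos assms ball_cong refl)
      (simp add: post_scale_dist_le_iff assms(1) fatten_norm_dist_in_balls pos)
qed

lemma beta_star_post_scale:
  assumes "a \<noteq> 0"
  shows "beta_star (norm_dist N) (norm_dist v) (v a) Q1 Q2
    = ennreal (inverse (v a)) * beta_star (norm_dist N) (norm_dist v) 1
        (post_scale (norm_dist N) a Q1) (post_scale (norm_dist N) a Q2)"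
  unfolding beta_star_def
proof (intro Inf_admissible_rescale v_pos assms ball_cong refl)
  fix \<epsilon> :: real and B assume \<epsilon>: "0 < \<epsilon>" and B: "B \<in> balls (norm_dist N)"
  let ?d = "norm_dist N"
  let ?p = "post_scale ?d a"
  note pos = v_pos[OF assms]
  \<comment> \<open>The witnesses, like \<open>\<epsilon>\<close>, are rescaled by \<open>v a\<close>, so that each enlargement stays the same set.\<close>
  have half: "(\<exists>\<delta>. 0 < \<delta> \<and> \<delta> \<le> \<epsilon> \<and> norm_dist v (P B) (Q (fatten ?d B (v a * \<delta>))) \<le> ennreal \<epsilon>)
      \<longleftrightarrow> (\<exists>\<delta>. 0 < \<delta> \<and> \<delta> \<le> v a * \<epsilon>
            \<and> norm_dist v (?p P B) (?p Q (fatten ?d B (1 * \<delta>))) \<le> ennreal (v a * \<epsilon>))"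
    (is "(\<exists>\<delta>. ?l \<delta>) \<longleftrightarrow> (\<exists>\<delta>. ?r \<delta>)") for P Q
  proof -
    have lr: "?l \<delta> \<longleftrightarrow> ?r (v a * \<delta>)" for \<delta>
      using pos \<epsilon> B
      by (cases "0 < \<delta>")
        (simp_all add: post_scale_dist_le_iff assms fatten_norm_dist_in_balls zero_less_mult_iff)
    have "?l (\<delta> / v a) \<longleftrightarrow> ?r \<delta>" for \<delta>
      using lr[of "\<delta> / v a"] pos by simp
    with lr show ?thesis by blast
  qed
  show "(\<exists>\<epsilon>1 \<epsilon>2. 0 < \<epsilon>1 \<and> \<epsilon>1 \<le> \<epsilon> \<and> 0 < \<epsilon>2 \<and> \<epsilon>2 \<le> \<epsilon>
          \<and> norm_dist v (Q1 B) (Q2 (fatten ?d B (v a * \<epsilon>1))) \<le> ennreal \<epsilon>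
          \<and> norm_dist v (Q2 B) (Q1 (fatten ?d B (v a * \<epsilon>2))) \<le> ennreal \<epsilon>)
      \<longleftrightarrow> (\<exists>\<epsilon>1 \<epsilon>2. 0 < \<epsilon>1 \<and> \<epsilon>1 \<le> v a * \<epsilon> \<and> 0 < \<epsilon>2 \<and> \<epsilon>2 \<le> v a * \<epsilon>
          \<and> norm_dist v (?p Q1 B) (?p Q2 (fatten ?d B (1 * \<epsilon>1))) \<le> ennreal (v a * \<epsilon>)
          \<and> norm_dist v (?p Q2 B) (?p Q1 (fatten ?d B (1 * \<epsilon>2))) \<le> ennreal (v a * \<epsilon>))"
    using half[of Q1 Q2] half[of Q2 Q1] by blast
qed

end

section \<open>The scaling identities\<close>

theorem theorem4p9:
  fixes v :: "'k::field \<Rightarrow> real"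
    and smul :: "'k \<Rightarrow> 'x::ab_group_add \<Rightarrow> 'x"
    and N :: "'x \<Rightarrow> real"
    and dY :: "'y \<Rightarrow> 'y \<Rightarrow> ennreal"
    and a :: 'k
  assumes "complete_nonarch_valued_field v"
    and "nonarch_normed_space v smul N"
    and "balls_nonsingleton (norm_dist N)"
    and "a \<noteq> 0"
  shows "(nonarch_metric dY \<longrightarrow> balls_nonsingleton dY \<longrightarrow>
            (\<forall>P1 \<in> ball_maps (norm_dist N). \<forall>P2 \<in> ball_maps (norm_dist N).
               beta (norm_dist N) dY (v a) P1 P2
                 = beta (norm_dist N) dY 1
                     (pre_scale (norm_dist N) smul a P1) (pre_scale (norm_dist N) smul a P2) \<and>
               beta_star (norm_dist N) dY (v a) P1 P2
                 = beta_star (norm_dist N) dY 1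
                     (pre_scale (norm_dist N) smul a P1) (pre_scale (norm_dist N) smul a P2))) \<and>
         (balls_nonsingleton (norm_dist v) \<longrightarrow>
            (\<forall>Q1 \<in> ball_maps (norm_dist N). \<forall>Q2 \<in> ball_maps (norm_dist N).
               beta (norm_dist N) (norm_dist v) (v a) Q1 Q2
                 = ennreal (inverse (v a)) * beta (norm_dist N) (norm_dist v) 1
                     (post_scale (norm_dist N) a Q1) (post_scale (norm_dist N) a Q2) \<and>
               beta_star (norm_dist N) (norm_dist v) (v a) Q1 Q2
                 = ennreal (inverse (v a)) * beta_star (norm_dist N) (norm_dist v) 1
                     (post_scale (norm_dist N) a Q1) (post_scale (norm_dist N) a Q2)))"
proof -
  interpret nonarch_normed_space v smul N by (rule assms(2))
  show ?thesis
    by (intro conjI impI ballI beta_pre_scale beta_star_pre_scale beta_post_scale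
        beta_star_post_scale assms(4))
qed

end
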